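(* For a weakly graded poset $P$, the following are equivalent: (I) $P$ is $(\mathbf{3+1})$-avoiding; (II) $P$ is vigilant and every two elements $v,w$ with $\operatorname{rk}(w)-\operatorname{rk}(v)\ge 2$ are comparable; (III) $P$ is vigilant and every two elements $v,w$ with $\operatorname{rk}(w)-\operatorname{rk}(v)=2$ are comparable.
   Context: All posets are finite. A poset $P$ is weakly graded if there is a function $\operatorname{rk}:P\to\mathbb{N}$ (the rank function) such that $\operatorname{rk}(b)=\operatorname{rk}(a)+1$ whenever $b$ covers $a$, and such that the minimum value of $\operatorname{rk}$ on each connected component of $P$ is $0$. Write $P(i)$ for the set of elements of rank $i$. An element $v$ of rank $i$ is up-seeing if every element of $P(i+1)$ covers $v$, and down-seeing if $v$ covers every element of $P(i-1)$ (these conditions hold vacuously if the relevant rank set is empty). $P$ is vigilant if every element is up-seeing or down-seeing (or both). A poset is $(\mathbf{3+1})$-avoiding if there are no four elements $x,y,z,w$ with $x<y<z$ and $w$ incomparable to each of $x,y,z$. *)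

theory Defs
  imports Main
begin

(* A poset is a carrier P together with a relation r such that partial_order_on P r holds;
   a pair (a, b) in r means a \<le> b. Using an explicit carrier keeps the empty poset. *)

definition poset_less :: "'a rel \<Rightarrow> 'a \<Rightarrow> 'a \<Rightarrow> bool" where
  "poset_less r a b \<longleftrightarrow> (a, b) \<in> r \<and> a \<noteq> b"

definition comparable :: "'a rel \<Rightarrow> 'a \<Rightarrow> 'a \<Rightarrow> bool" where
  "comparable r a b \<longleftrightarrow> (a, b) \<in> r \<or> (b, a) \<in> r"

definition covers :: "'a set \<Rightarrow> 'a rel \<Rightarrow> 'a \<Rightarrow> 'a \<Rightarrow> bool" where
  "covers P r b a \<longleftrightarrow> poset_less r a b \<and> \<not> (\<exists>c\<in>P. poset_less r a c \<and> poset_less r c b)"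

(* Classes of the equivalence relation on P generated by comparability. The order r is
   reflexive on P and contained in P \<times> P, so the transitive closure of its symmetrization
   is already an equivalence on P. *)
definition components :: "'a set \<Rightarrow> 'a rel \<Rightarrow> 'a set set" where
  "components P r = P // (r \<union> r\<inverse>)\<^sup>+"

(* P is weakly graded if it has such a function; it is then unique on P. *)
definition rank_function :: "'a set \<Rightarrow> 'a rel \<Rightarrow> ('a \<Rightarrow> nat) \<Rightarrow> bool" where
  "rank_function P r rk \<longleftrightarrow>
     (\<forall>a\<in>P. \<forall>b\<in>P. covers P r b a \<longrightarrow> rk b = rk a + 1) \<and>
     (\<forall>C\<in>components P r. Min (rk ` C) = 0)"

(* P(i); the index is an integer so that P(-1) is empty rather than equal to P(0). *)
definition rank_set :: "'a set \<Rightarrow> ('a \<Rightarrow> nat) \<Rightarrow> int \<Rightarrow> 'a set" where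
  "rank_set P rk i = {v \<in> P. int (rk v) = i}"

definition up_seeing :: "'a set \<Rightarrow> 'a rel \<Rightarrow> ('a \<Rightarrow> nat) \<Rightarrow> 'a \<Rightarrow> bool" where
  "up_seeing P r rk v \<longleftrightarrow> (\<forall>u\<in>rank_set P rk (int (rk v) + 1). covers P r u v)"

definition down_seeing :: "'a set \<Rightarrow> 'a rel \<Rightarrow> ('a \<Rightarrow> nat) \<Rightarrow> 'a \<Rightarrow> bool" where
  "down_seeing P r rk v \<longleftrightarrow> (\<forall>u\<in>rank_set P rk (int (rk v) - 1). covers P r v u)"

definition vigilant :: "'a set \<Rightarrow> 'a rel \<Rightarrow> ('a \<Rightarrow> nat) \<Rightarrow> bool" where
  "vigilant P r rk \<longleftrightarrow> (\<forall>v\<in>P. up_seeing P r rk v \<or> down_seeing P r rk v)"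

definition three_plus_one_avoiding :: "'a set \<Rightarrow> 'a rel \<Rightarrow> bool" where
  "three_plus_one_avoiding P r \<longleftrightarrow>
     \<not> (\<exists>x\<in>P. \<exists>y\<in>P. \<exists>z\<in>P. \<exists>w\<in>P. poset_less r x y \<and> poset_less r y z \<and>
          \<not> comparable r w x \<and> \<not> comparable r w y \<and> \<not> comparable r w z)"

end

theory Submission
  imports Defs
begin

text \<open>
  A set of elements closed under comparability contains a whole component, hence an element of
  rank 0 as soon as it is nonempty. In a poset avoiding 3+1, consider the elements that lie below
  some element of rank at least s + 2 which in turn is above no element of rank s. This set is
  closed under comparability but contains no element of rank 0, so it is empty: every element of
  rank at least s + 2 lies above one of rank s. Applied with s two below the rank of w, this yields
  a chain c < y < w of consecutive ranks, and any v at least two ranks below w can only be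
  comparable to a member of that chain by lying below it.
\<close>

locale weakly_graded_poset =
  fixes P :: "'a set" and r :: "'a rel" and rk :: "'a \<Rightarrow> nat"
  assumes finite_carrier: "finite P"
    and partial_order: "partial_order_on P r"
    and rank_function: "rank_function P r rk"
begin

section \<open>Covers, rank and interpolation along the order\<close>

lemma rel_in_carrier: "(a, b) \<in> r \<Longrightarrow> a \<in> P \<and> b \<in> P"
  using partial_order by (auto simp: partial_order_on_def preorder_on_def)

lemma rel_refl: "a \<in> P \<Longrightarrow> (a, a) \<in> r"
  using partial_order by (auto simp: partial_order_on_def preorder_on_def refl_on_def)

lemma rel_trans: "(a, b) \<in> r \<Longrightarrow> (b, c) \<in> r \<Longrightarrow> (a, c) \<in> r"
  using partial_order unfolding partial_order_on_def preorder_on_def by (meson transD)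

lemma rel_antisym: "(a, b) \<in> r \<Longrightarrow> (b, a) \<in> r \<Longrightarrow> a = b"
  using partial_order unfolding partial_order_on_def by (meson antisymD)

text \<open>Any element strictly between \<open>a\<close> and \<open>b\<close> can replace
  \<open>b\<close>. The set \<open>?S b\<close> then shrinks, since \<open>b\<close> itself leaves
  it, so in a finite poset this stops at a cover of \<open>a\<close>.\<close>

lemma cover_below:
  assumes "(a, b) \<in> r" "a \<noteq> b"
  obtains c where "c \<in> P" "covers P r c a" "(c, b) \<in> r"
proof -
  let ?S = "\<lambda>b. {c \<in> P. (a, c) \<in> r \<and> a \<noteq> c \<and> (c, b) \<in> r}"
  have "\<exists>c \<in> P. covers P r c a \<and> (c, b) \<in> r" if "(a, b) \<in> r" "a \<noteq> b" for b
    using that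
  proof (induction "card (?S b)" arbitrary: b rule: less_induct)
    case less
    show ?case
    proof (cases "covers P r b a")
      case True
      then show ?thesis using less.prems rel_in_carrier rel_refl by blast
    next
      case False
      then obtain c where c: "c \<in> P" "(a, c) \<in> r" "a \<noteq> c" "(c, b) \<in> r" "c \<noteq> b"
        using less.prems unfolding covers_def poset_less_def by blast
      have "?S c \<subseteq> ?S b" using c rel_trans by blast
      moreover have "b \<in> ?S b" "b \<notin> ?S c"
        using less.prems c rel_antisym rel_refl rel_in_carrier by blast+
      ultimately have "card (?S c) < card (?S b)"
        by (intro psubset_card_mono) (auto simp: finite_carrier)
      from less.hyps[OF this c(2,3)] show ?thesis using c rel_trans by blast
    qed
  qed
  with assms that show thesis by blast
qed

lemma rank_cover: "covers P r b a \<Longrightarrow> rk b = rk a + 1"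
  using rank_function rel_in_carrier
  unfolding rank_function_def covers_def poset_less_def by blast

text \<open>Climbing from \<open>a\<close> to \<open>b\<close> one cover at a time raises the rank
  by exactly 1 per step, so no intermediate rank is skipped. The induction is on the size of the
  up-set of \<open>a\<close>.\<close>

lemma rank_mono_and_interpolate:
  assumes "(a, b) \<in> r"
  shows "rk a \<le> rk b \<and> (rk a = rk b \<longrightarrow> a = b)
    \<and> (\<forall>k. rk a \<le> k \<and> k \<le> rk b \<longrightarrow> (\<exists>c. (a, c) \<in> r \<and> (c, b) \<in> r \<and> rk c = k))"
  using assms
proof (induction "card {c \<in> P. (a, c) \<in> r}" arbitrary: a rule: less_induct)
  case less
  show ?case
  proof (cases "a = b")
    case True
    then show ?thesis using less.prems by auto
  next
    case False
    with less.prems obtain c where c: "c \<in> P" "covers P r c a" "(c, b) \<in> r"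
      by (rule cover_below)
    then have ac: "(a, c) \<in> r" "a \<noteq> c" by (auto simp: covers_def poset_less_def)
    have "{d \<in> P. (c, d) \<in> r} \<subseteq> {d \<in> P. (a, d) \<in> r}" using ac rel_trans by blast
    moreover have "a \<in> {d \<in> P. (a, d) \<in> r}" "a \<notin> {d \<in> P. (c, d) \<in> r}"
      using ac rel_antisym rel_refl rel_in_carrier by blast+
    ultimately have "card {d \<in> P. (c, d) \<in> r} < card {d \<in> P. (a, d) \<in> r}"
      by (intro psubset_card_mono) (auto simp: finite_carrier)
    from less.hyps[OF this c(3)]
    have IH: "rk c \<le> rk b"
      "\<And>k. rk c \<le> k \<Longrightarrow> k \<le> rk b \<Longrightarrow> \<exists>d. (c, d) \<in> r \<and> (d, b) \<in> r \<and> rk d = k"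
      by blast+
    have "rk c = rk a + 1" using c(2) by (rule rank_cover)
    moreover have "\<exists>d. (a, d) \<in> r \<and> (d, b) \<in> r \<and> rk d = k" if "rk a \<le> k" "k \<le> rk b" for k
    proof (cases "k = rk a")
      case True
      then show ?thesis using less.prems rel_in_carrier rel_refl by blast
    next
      case False
      then have "rk c \<le> k" using that \<open>rk c = rk a + 1\<close> by simp
      then show ?thesis using IH(2) that ac rel_trans by blast
    qed
    ultimately show ?thesis using IH(1) by auto
  qed
qed

lemma rank_mono: "(a, b) \<in> r \<Longrightarrow> rk a \<le> rk b"
  and rank_eq_imp_eq: "(a, b) \<in> r \<Longrightarrow> rk a = rk b \<Longrightarrow> a = b"
  using rank_mono_and_interpolate by blast+

lemma interpolate:
  assumes "(a, b) \<in> r" "rk a \<le> k" "k \<le> rk b"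
  obtains c where "(a, c) \<in> r" "(c, b) \<in> r" "rk c = k"
  using rank_mono_and_interpolate[OF assms(1)] assms(2,3) by blast

text \<open>Rank grows strictly along strict relations, so a gap of 1 leaves no room in between.
  This turns up- and down-seeing into conditions on ranks and \<open>r\<close> alone.\<close>

lemma covers_iff_rank: "covers P r b a \<longleftrightarrow> (a, b) \<in> r \<and> rk b = rk a + 1"
proof
  assume "covers P r b a"
  then show "(a, b) \<in> r \<and> rk b = rk a + 1"
    using rank_cover by (auto simp: covers_def poset_less_def)
next
  assume ab: "(a, b) \<in> r \<and> rk b = rk a + 1"
  have False if "(a, c) \<in> r" "a \<noteq> c" "(c, b) \<in> r" "c \<noteq> b" for c
    using rank_mono[of a c] rank_mono[of c b] rank_eq_imp_eq[of a c] rank_eq_imp_eq[of c b] ab that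
    by force
  then show "covers P r b a" using ab by (auto simp: covers_def poset_less_def)
qed

lemma comparable_imp_rel:
  assumes "comparable r a b" "rk a < rk b"
  shows "(a, b) \<in> r"
  using assms rank_mono[of b a] by (auto simp: comparable_def)

section \<open>Ranks within a component\<close>

lemma comparability_closed_has_rank_zero:
  assumes w: "w \<in> P" "w \<in> T"
    and closed: "\<And>p q. p \<in> T \<Longrightarrow> (p, q) \<in> r \<Longrightarrow> q \<in> T" "\<And>p q. p \<in> T \<Longrightarrow> (q, p) \<in> r \<Longrightarrow> q \<in> T"
  obtains p where "p \<in> T" "rk p = 0"
proof -
  let ?C = "(r \<union> r\<inverse>)\<^sup>+ `` {w}"
  have "?C \<in> components P r" using w(1) by (auto simp: components_def quotient_def)
  then have "Min (rk ` ?C) = 0" using rank_function by (auto simp: rank_function_def)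
  moreover have "(w, q) \<in> (r \<union> r\<inverse>)\<^sup>+ \<Longrightarrow> q \<in> P \<and> q \<in> T" for q
    by (induction rule: trancl_induct) (use w closed rel_in_carrier in blast)+
  then have "?C \<subseteq> P \<inter> T" by blast
  moreover have "w \<in> ?C" using w(1) rel_refl by blast
  \<comment> \<open>\<open>Min\<close> is known to be attained only on a finite nonempty set, hence
    the facts \<open>?C \<subseteq> P \<inter> T\<close> and \<open>w \<in> ?C\<close>.\<close>
  ultimately have "0 \<in> rk ` ?C"
    using Min_in[of "rk ` ?C"] finite_carrier by (metis empty_iff finite_Int finite_imageI
        finite_subset image_is_empty)
  with \<open>?C \<subseteq> P \<inter> T\<close> that show thesis by fastforce
qed

text \<open>If rank \<open>s\<close> were missing, the elements of rank above \<open>s\<close> would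
  be closed under comparability, because a descent past \<open>s\<close> passes through rank
  \<open>s\<close>; yet none of them has rank 0.\<close>

lemma ex_rank:
  assumes "w \<in> P" "s \<le> rk w"
  obtains u where "u \<in> P" "rk u = s"
proof (rule ccontr)
  assume "\<not> thesis"
  then have no: "rk u \<noteq> s" if "u \<in> P" for u
    using \<open>\<And>u. u \<in> P \<Longrightarrow> rk u = s \<Longrightarrow> thesis\<close> that by blast
  have "\<exists>p. p \<in> {p. s < rk p} \<and> rk p = 0"
  proof (rule comparability_closed_has_rank_zero[of w "{p. s < rk p}"])
    show "w \<in> {p. s < rk p}" using no assms by (simp add: order.strict_iff_order) metis
    show "q \<in> {p. s < rk p}" if "p \<in> {p. s < rk p}" "(p, q) \<in> r" for p q
      using that rank_mono by fastforce
    show "q \<in> {p. s < rk p}" if p: "p \<in> {p. s < rk p}" and qp: "(q, p) \<in> r" for p q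
    proof (rule ccontr)
      assume "q \<notin> {p. s < rk p}"
      then obtain c where "(q, c) \<in> r" "rk c = s"
        using interpolate[OF qp, of s] p by auto
      then show False using no rel_in_carrier by blast
    qed
  qed (use assms in blast)+
  then show False by auto
qed

section \<open>Consequences of avoiding 3+1\<close>

lemma avoiding_comparable:
  assumes "three_plus_one_avoiding P r" "(x, y) \<in> r" "x \<noteq> y" "(y, z) \<in> r" "y \<noteq> z" "w \<in> P"
  shows "comparable r w x \<or> comparable r w y \<or> comparable r w z"
  using assms rel_in_carrier unfolding three_plus_one_avoiding_def poset_less_def by meson

lemma avoiding_ex_below:
  assumes av: "three_plus_one_avoiding P r" and w: "w \<in> P" "s + 2 \<le> rk w"
  obtains c where "(c, w) \<in> r" "rk c = s"
proof (rule ccontr)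
  assume "\<not> thesis"
  then have no: "\<nexists>c. (c, w) \<in> r \<and> rk c = s" using that by blast
  \<comment> \<open>Placing \<open>p\<close> below a witness \<open>p'\<close> makes closure
    downwards immediate by transitivity; closure upwards comes from avoidance.\<close>
  define T where "T = {p. \<exists>p'. (p, p') \<in> r \<and> s + 2 \<le> rk p' \<and> (\<nexists>c. (c, p') \<in> r \<and> rk c = s)}"
  have T_rank: "s < rk p" if p: "p \<in> T" for p
  proof (rule ccontr)
    obtain p' where p': "(p, p') \<in> r" "s + 2 \<le> rk p'" "\<nexists>c. (c, p') \<in> r \<and> rk c = s"
      using p unfolding T_def by blast
    assume "\<not> s < rk p"
    then show False using interpolate[OF p'(1), of s] p'(2,3) by auto
  qed
  have "\<exists>p. p \<in> T \<and> rk p = 0"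
  proof (rule comparability_closed_has_rank_zero[of w T])
    show "w \<in> T" using w no rel_refl unfolding T_def by blast
    show "q \<in> T" if "p \<in> T" "(q, p) \<in> r" for p q
      using that rel_trans unfolding T_def by blast
    show "q \<in> T" if p: "p \<in> T" and pq: "(p, q) \<in> r" for p q
    proof (cases "p = q")
      case False
      then have rq: "s + 2 \<le> rk q"
        using T_rank[OF p] rank_mono[OF pq] rank_eq_imp_eq[OF pq] by force
      obtain p' where p': "(p, p') \<in> r" "s + 2 \<le> rk p'" "\<nexists>c. (c, p') \<in> r \<and> rk c = s"
        using p unfolding T_def by blast
      \<comment> \<open>An element \<open>c\<close> of rank \<open>s\<close> below \<open>q\<close>
        would start a chain \<open>c\<close>, \<open>y\<close>, \<open>z\<close> of ranks
        \<open>s\<close>, \<open>s + 1\<close>, \<open>s + 2\<close>, with \<open>p'\<close> as the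
        isolated fourth element. Hence \<open>q\<close> can be its own witness.\<close>
      have "\<nexists>c. (c, q) \<in> r \<and> rk c = s"
      proof
        assume "\<exists>c. (c, q) \<in> r \<and> rk c = s"
        then obtain c where c: "(c, q) \<in> r" "rk c = s" by blast
        obtain z where z: "(c, z) \<in> r" "rk z = s + 2"
          using interpolate[OF c(1), of "s + 2"] c(2) rq by auto
        obtain y where y: "(c, y) \<in> r" "(y, z) \<in> r" "rk y = s + 1"
          using interpolate[OF z(1), of "s + 1"] c(2) z(2) by auto
        \<comment> \<open>If \<open>u\<close> were below \<open>p'\<close>, then so would be
          \<open>c\<close>, against the choice of \<open>p'\<close>. If \<open>p'\<close> were below
          \<open>u\<close>, the ranks would force \<open>p' = u\<close>, and again \<open>c\<close>
          would lie below \<open>p'\<close>.\<close>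
        have incomp: "\<not> comparable r p' u" if "(c, u) \<in> r" "rk u \<le> s + 2" for u
          using that p'(2,3) c(2) rel_trans[OF that(1), of p'] rank_mono[of p' u]
            rank_eq_imp_eq[of p' u]
          unfolding comparable_def by (metis order.trans order_antisym)
        show False
          using avoiding_comparable[OF av y(1) _ y(2), of p'] incomp[of c] incomp[of y] incomp[of z]
            c y z p'(1) rel_in_carrier rel_refl by force
      qed
      then show ?thesis using rq pq rel_in_carrier rel_refl unfolding T_def by blast
    qed (use p in simp)
  qed (use w in blast)+
  then show False using T_rank by fastforce
qed

lemma avoiding_imp_comparable:
  assumes av: "three_plus_one_avoiding P r" and "v \<in> P" "w \<in> P" "rk v + 2 \<le> rk w"
  shows "comparable r v w"
proof -
  \<comment> \<open>The natural-number subtractions are exact, since \<open>rk w\<close> is at least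
    2.\<close>
  obtain c where c: "(c, w) \<in> r" "rk c = rk w - 2"
    using avoiding_ex_below[OF av \<open>w \<in> P\<close>, of "rk w - 2"] assms(4)
    by (metis add_leD2 le_add_diff_inverse2 order_refl)
  obtain y where y: "(c, y) \<in> r" "(y, w) \<in> r" "rk y = rk w - 1"
    using interpolate[OF c(1), of "rk w - 1"] c(2) diff_le_self diff_le_mono2[of 1 2 "rk w"] by auto
  have "c \<noteq> y" "y \<noteq> w" using c y assms(4) by auto
  then consider "comparable r v c" | "comparable r v y" | "comparable r v w"
    using avoiding_comparable[OF av y(1) _ y(2) _ \<open>v \<in> P\<close>] by blast
  then have "(v, w) \<in> r"
  proof cases
    case 1
    \<comment> \<open>The ranks of \<open>v\<close> and \<open>c\<close> may coincide; comparability
      then forces \<open>v = c\<close>.\<close>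
    then have "(v, c) \<in> r"
      using rank_mono[of c v] rank_eq_imp_eq[of c v] c(2) assms(2,4) rel_refl
      by (force simp: comparable_def)
    then show ?thesis using c(1) by (rule rel_trans)
  next
    case 2
    then have "(v, y) \<in> r" using y(3) assms(4) by (intro comparable_imp_rel) auto
    then show ?thesis using y(2) by (rule rel_trans)
  next
    case 3
    then show ?thesis using assms(4) by (intro comparable_imp_rel) auto
  qed
  then show ?thesis by (simp add: comparable_def)
qed

text \<open>If \<open>v\<close> sees neither way, some \<open>a\<close> one rank below and some
  \<open>b\<close> one rank above are unrelated to \<open>v\<close>. Their ranks differ by 2, so
  \<open>a\<close> lies below \<open>b\<close>, and an element \<open>y\<close> between them
  completes a chain incomparable to \<open>v\<close>.\<close>

lemma avoiding_imp_vigilant: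
  assumes av: "three_plus_one_avoiding P r"
  shows "vigilant P r rk"
  unfolding vigilant_def
proof (rule ballI, rule ccontr)
  fix v assume v: "v \<in> P" and "\<not> (up_seeing P r rk v \<or> down_seeing P r rk v)"
  then obtain a b where a: "a \<in> P" "rk v = rk a + 1" "(a, v) \<notin> r"
    and b: "b \<in> P" "rk b = rk v + 1" "(v, b) \<notin> r"
    unfolding up_seeing_def down_seeing_def rank_set_def covers_iff_rank by auto
  have "comparable r a b" using av a b by (intro avoiding_imp_comparable) auto
  then have "(a, b) \<in> r" using a b by (intro comparable_imp_rel) auto
  then obtain y where y: "(a, y) \<in> r" "(y, b) \<in> r" "rk y = rk v"
    using interpolate[of a b "rk v"] a b by auto
  have "\<not> comparable r v a" "\<not> comparable r v b"
    using a b rank_mono[of v a] rank_mono[of b v] by (auto simp: comparable_def)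
  \<comment> \<open>At equal rank, comparable means equal, but \<open>a\<close> is below
    \<open>y\<close> and not below \<open>v\<close>.\<close>
  moreover have "\<not> comparable r v y"
    using y a rank_eq_imp_eq[of v y] rank_eq_imp_eq[of y v] by (auto simp: comparable_def)
  ultimately show False
    using avoiding_comparable[OF av y(1) _ y(2) _ v] a b y(3) by force
qed

section \<open>From vigilance and comparability back to avoidance\<close>

lemma comparable_rank_diff_ge_2:
  assumes "\<forall>v\<in>P. \<forall>w\<in>P. rk w = rk v + 2 \<longrightarrow> comparable r v w"
    and "v \<in> P" "w \<in> P" "rk v + 2 \<le> rk w"
  shows "(v, w) \<in> r"
  using assms(2,4)
proof (induction "rk w - rk v" arbitrary: v rule: less_induct)
  case less
  \<comment> \<open>The element \<open>u\<close> need not be related to \<open>w\<close>. It only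
    ensures that something of rank \<open>rk v + 1\<close> lies above \<open>v\<close>, from which
    the induction continues with a smaller gap.\<close>
  obtain u where u: "u \<in> P" "rk u = rk v + 2"
    using ex_rank[OF \<open>w \<in> P\<close>] less.prems(2) by blast
  have vu: "(v, u) \<in> r" using u assms(1) less.prems by (intro comparable_imp_rel) auto
  show ?case
  proof (cases "rk w = rk v + 2")
    case True
    then show ?thesis using assms(1,3) less.prems by (intro comparable_imp_rel) auto
  next
    case False
    obtain a where a: "(v, a) \<in> r" "rk a = rk v + 1"
      using interpolate[OF vu, of "rk v + 1"] u by auto
    then have "(a, w) \<in> r" using less.hyps[of a] less.prems False rel_in_carrier by auto
    with a(1) show ?thesis by (rule rel_trans)
  qed
qed

text \<open>In a forbidden configuration \<open>w\<close> is at most one rank above \<open>x\<close>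
  and at most one below \<open>z\<close>, while \<open>x\<close> and \<open>z\<close> are at least
  two ranks apart. So \<open>w\<close> sits exactly midway and sees neither \<open>z\<close> above
  nor \<open>x\<close> below.\<close>

lemma vigilant_comparable_imp_avoiding:
  assumes vig: "vigilant P r rk"
    and comp: "\<And>v w. v \<in> P \<Longrightarrow> w \<in> P \<Longrightarrow> rk v + 2 \<le> rk w \<Longrightarrow> comparable r v w"
  shows "three_plus_one_avoiding P r"
  unfolding three_plus_one_avoiding_def
proof (rule notI, elim bexE conjE)
  fix x y z w
  assume P: "x \<in> P" "y \<in> P" "z \<in> P" "w \<in> P"
    and xy: "poset_less r x y" and yz: "poset_less r y z"
    and nx: "\<not> comparable r w x" and nz: "\<not> comparable r w z"
  have "rk x < rk y" "rk y < rk z"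
    using xy yz rank_mono rank_eq_imp_eq
    unfolding poset_less_def by (metis order.not_eq_order_implies_strict)+
  moreover have "\<not> rk x + 2 \<le> rk w" "\<not> rk w + 2 \<le> rk z"
    using P comp nx nz by (auto simp: comparable_def)
  ultimately have rx: "rk w = rk x + 1" and rz: "rk z = rk w + 1" by linarith+
  have "\<not> up_seeing P r rk w" "\<not> down_seeing P r rk w"
    using P rx rz nx nz
    by (auto simp: up_seeing_def down_seeing_def rank_set_def covers_iff_rank comparable_def)
  then show False using vig P by (auto simp: vigilant_def)
qed

end

theorem theorem3p1:
  fixes P :: "'a set" and r :: "'a rel" and rk :: "'a \<Rightarrow> nat"
  assumes "finite P" and "partial_order_on P r"
    and "rank_function P r rk"
  shows "(three_plus_one_avoiding P r \<longleftrightarrow>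
            vigilant P r rk \<and>
            (\<forall>v\<in>P. \<forall>w\<in>P. int (rk w) - int (rk v) \<ge> 2 \<longrightarrow> comparable r v w))
       \<and> (vigilant P r rk \<and>
            (\<forall>v\<in>P. \<forall>w\<in>P. int (rk w) - int (rk v) \<ge> 2 \<longrightarrow> comparable r v w)
          \<longleftrightarrow>
            vigilant P r rk \<and>
            (\<forall>v\<in>P. \<forall>w\<in>P. int (rk w) - int (rk v) = 2 \<longrightarrow> comparable r v w))"
proof -
  interpret weakly_graded_poset P r rk using assms by unfold_locales
  have ge: "int (rk w) - int (rk v) \<ge> 2 \<longleftrightarrow> rk v + 2 \<le> rk w"
    and eq: "int (rk w) - int (rk v) = 2 \<longleftrightarrow> rk w = rk v + 2" for v w
    by linarith+
  have "comparable r v w"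
    if "\<forall>v\<in>P. \<forall>w\<in>P. rk w = rk v + 2 \<longrightarrow> comparable r v w" "v \<in> P" "w \<in> P" "rk v + 2 \<le> rk w"
    for v w
    using comparable_rank_diff_ge_2[OF that] by (simp add: comparable_def)
  then have "(\<forall>v\<in>P. \<forall>w\<in>P. rk v + 2 \<le> rk w \<longrightarrow> comparable r v w) \<longleftrightarrow>
      (\<forall>v\<in>P. \<forall>w\<in>P. rk w = rk v + 2 \<longrightarrow> comparable r v w)"
    by (metis order_refl)
  moreover have "three_plus_one_avoiding P r \<longleftrightarrow> vigilant P r rk \<and>
      (\<forall>v\<in>P. \<forall>w\<in>P. rk v + 2 \<le> rk w \<longrightarrow> comparable r v w)"
    using avoiding_imp_comparable avoiding_imp_vigilant vigilant_comparable_imp_avoiding by blast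
  ultimately show ?thesis
    unfolding ge eq by blast
qed

end
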